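(* Consider the two-stage inventory problem described in the context with $y_1=0$, $\rho=1$, $$\mathcal I_1=[1,3],\ \mu_1=2,\ \sigma_1=1,\ c_1=0,\ b_1=0,\ h_1=0;\qquad \mathcal I_2=\mathbb R_+,\ \mu_2=100,\ \sigma_2=5,\ c_2=2,\ b_2=1,\ h_2=1.$$ Let $\Pi_s^{opt}$ be the set of all optimal policies of the multistage-static problem. Let $\tilde\Pi$ be the set of policies $(\tilde x_1,\tilde x_2)\in\Pi$ with $\tilde x_1=102$, with $\tilde x_2=101$ when $y_2=101$ (i.e. when $d_1=1$), and with $\tilde x_2=99$ when $y_2=99$ (i.e. when $d_1=3$), the behavior at all other values of $d_1$ being arbitrary subject to membership in $\Pi$. Then $\Pi_s^{opt}=\tilde\Pi$, and the multistage-static problem is strongly time consistent. However, the optimal value of the multistage-static problem equals $5$, while the optimal value of the distributionally robust DP problem equals $\sqrt{26}>5$.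
   Context: Two-stage setting ($T=2$). $\rho\in(0,1]$ is a discount factor, $y_1\in\mathbb R$ a given initial inventory level. For $t=1,2$: $c_t,b_t,h_t\ge 0$ are ordering, backorder and holding costs; $\mathcal I_t\subseteq\mathbb R_+$ is a closed interval; $\mathcal M_t$ is the set of probability measures $Q_t$ on $\mathbb R$ with support in $\mathcal I_t$, $\mathbb E_{Q_t}[D_t]=\mu_t$, $\mathbb E_{Q_t}[D_t^2]=\mu_t^2+\sigma_t^2$. Let $\mathcal M=\{Q_1\times Q_2: Q_1\in\mathcal M_1,\ Q_2\in\mathcal M_2\}$ (product measures for $(D_1,D_2)$). Write $[a]_+=\max\{a,0\}$. Policies. $\Pi$ is the set of admissible policies $\pi=(x_1,x_2)$, where $x_1\in\mathbb R$ is a constant with $x_1\ge y_1$ and $x_2:\mathbb R_+\to\mathbb R$ is a measurable function of the first-stage demand $d_1$ with $x_2(d_1)\ge y_2(d_1):=x_1-d_1$ for all $d_1\in\mathbb R_+$. Costs. $\Psi_t(x,d)=b_t[d-x]_++h_t[x-d]_+$ and $$Z^\pi(D_1,D_2)=c_1(x_1-y_1)+\Psi_1(x_1,D_1)+\rho\big[c_2(x_2(D_1)-y_2(D_1))+\Psi_2(x_2(D_1),D_2)\big].$$ Multistage-static problem: $\inf_{\pi\in\Pi}\sup_{Q\in\mathcal M}\mathbb E_Q[Z^\pi]$; $\pi$ is optimal if it attains the infimum. Distributionally robust DP problem: $V_3\equiv0$ and, for $t=2,1$, $$V_t(y)=\inf_{x\ge y}\Big\{c_t(x-y)+\sup_{Q_t\in\mathcal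 M_t}\mathbb E_{Q_t}[\Psi_t(x,D_t)+\rho V_{t+1}(x-D_t)]\Big\},$$ $\mathcal Y_t(y)$ is the set of minimizers $x\ge y$, and the optimal value is $V_1(y_1)$. A policy $\pi\in\Pi$ is robust-w.p.1-optimal for the DP problem if $x_1\in\mathcal Y_1(y_1)$ and, for every $Q\in\mathcal M$, $x_2(D_1)\in\mathcal Y_2(y_2(D_1))$ with probability one under $Q$. Time consistency. A policy is time consistent if it is optimal for the multistage-static problem and robust-w.p.1-optimal for the DP problem. The multistage-static problem is strongly time consistent if every one of its optimal policies is time consistent. *)

theory Defs
  imports "HOL-Probability.Probability"
begin

text \<open>The per-stage data are functions of the stage index, of which only the values at 1 and 2
  are used.\<close>

record inventory =
  discount :: real
  init_level :: real
  order_cost :: "nat \<Rightarrow> real"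
  backorder_cost :: "nat \<Rightarrow> real"
  holding_cost :: "nat \<Rightarrow> real"
  demand_range :: "nat \<Rightarrow> real set"
  mean :: "nat \<Rightarrow> real"
  std_dev :: "nat \<Rightarrow> real"

definition inventory_problem :: "inventory \<Rightarrow> bool" where
  "inventory_problem P \<longleftrightarrow>
     0 < discount P \<and> discount P \<le> 1 \<and>
     (\<forall>t\<in>{1, 2}. 0 \<le> order_cost P t \<and> 0 \<le> backorder_cost P t \<and> 0 \<le> holding_cost P t \<and>
        closed (demand_range P t) \<and> is_interval (demand_range P t) \<and> demand_range P t \<subseteq> {0..})"

text \<open>Since the demand ranges are closed, the topological support of \<open>Q\<close> lies in the range
  iff the range has full measure. Integrability is required explicitly because the Bochner
  integral of a non-integrable function is 0.\<close>

definition ambiguity_set :: "inventory \<Rightarrow> nat \<Rightarrow> real measure set" where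
  "ambiguity_set P t =
     {Q. prob_space Q \<and> sets Q = sets borel \<and>
         (AE d in Q. d \<in> demand_range P t) \<and>
         integrable Q (\<lambda>d. d) \<and> (\<integral>d. d \<partial>Q) = mean P t \<and>
         integrable Q (\<lambda>d. d\<^sup>2) \<and> (\<integral>d. d\<^sup>2 \<partial>Q) = (mean P t)\<^sup>2 + (std_dev P t)\<^sup>2}"

definition joint_ambiguity_set :: "inventory \<Rightarrow> (real \<times> real) measure set" where
  "joint_ambiguity_set P =
     {Q1 \<Otimes>\<^sub>M Q2 | Q1 Q2. Q1 \<in> ambiguity_set P 1 \<and> Q2 \<in> ambiguity_set P 2}"

type_synonym policy = "real \<times> (real \<Rightarrow> real)"

text \<open>A second-stage rule is a function on the nonnegative reals; extensionality makes equality
  of policies mean equality of these functions.\<close>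

definition policies :: "inventory \<Rightarrow> policy set" where
  "policies P =
     {(x1, x2). init_level P \<le> x1 \<and>
        x2 \<in> extensional {0..} \<and>
        x2 \<in> borel_measurable (restrict_space borel {0..}) \<and>
        (\<forall>d1\<ge>0. x1 - d1 \<le> x2 d1)}"

definition stage_cost :: "inventory \<Rightarrow> nat \<Rightarrow> real \<Rightarrow> real \<Rightarrow> real" where
  "stage_cost P t x d = backorder_cost P t * max (d - x) 0 + holding_cost P t * max (x - d) 0"

definition total_cost :: "inventory \<Rightarrow> policy \<Rightarrow> real \<times> real \<Rightarrow> real" where
  "total_cost P = (\<lambda>(x1, x2) (d1, d2).
     order_cost P 1 * (x1 - init_level P) + stage_cost P 1 x1 d1
     + discount P * (order_cost P 2 * (x2 d1 - (x1 - d1)) + stage_cost P 2 (x2 d1) d2))"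

text \<open>All costs are nonnegative, so expectations are taken in \<^typ>\<open>ennreal\<close>, where they always
  exist, possibly with value infinity.\<close>

lemma total_cost_nonneg:
  assumes "inventory_problem P" "\<pi> \<in> policies P" "0 \<le> fst \<omega>"
  shows "0 \<le> total_cost P \<pi> \<omega>"
  using assms
  by (auto simp: inventory_problem_def policies_def total_cost_def stage_cost_def
      split: prod.splits intro!: add_nonneg_nonneg mult_nonneg_nonneg)

definition worst_case_cost :: "inventory \<Rightarrow> policy \<Rightarrow> ennreal" where
  "worst_case_cost P \<pi> =
     (SUP Q\<in>joint_ambiguity_set P. \<integral>\<^sup>+ \<omega>. ennreal (total_cost P \<pi> \<omega>) \<partial>Q)"

definition static_value :: "inventory \<Rightarrow> ennreal" where
  "static_value P = (INF \<pi>\<in>policies P. worst_case_cost P \<pi>)"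

definition static_optimal_policies :: "inventory \<Rightarrow> policy set" where
  "static_optimal_policies P = {\<pi> \<in> policies P. worst_case_cost P \<pi> = static_value P}"

definition dp_objective ::
    "inventory \<Rightarrow> nat \<Rightarrow> (real \<Rightarrow> ennreal) \<Rightarrow> real \<Rightarrow> real \<Rightarrow> ennreal" where
  "dp_objective P t V y x =
     ennreal (order_cost P t * (x - y)) +
     (SUP Q\<in>ambiguity_set P t.
        \<integral>\<^sup>+ d. (ennreal (stage_cost P t x d) + ennreal (discount P) * V (x - d)) \<partial>Q)"

function dp_value_function :: "inventory \<Rightarrow> nat \<Rightarrow> real \<Rightarrow> ennreal" where
  "dp_value_function P t =
     (if 3 \<le> t then (\<lambda>_. 0)
      else (\<lambda>y. INF x\<in>{y..}. dp_objective P t (dp_value_function P (Suc t)) y x))"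
  by pat_completeness auto
termination
  by (relation "Wellfounded.measure (\<lambda>(P, t). 3 - t)") auto

declare dp_value_function.simps [simp del]

definition dp_minimizers :: "inventory \<Rightarrow> nat \<Rightarrow> real \<Rightarrow> real set" where
  "dp_minimizers P t y =
     {x \<in> {y..}. dp_objective P t (dp_value_function P (Suc t)) y x = dp_value_function P t y}"

definition dp_optimal_value :: "inventory \<Rightarrow> ennreal" where
  "dp_optimal_value P = dp_value_function P 1 (init_level P)"

definition robust_wp1_optimal :: "inventory \<Rightarrow> policy \<Rightarrow> bool" where
  "robust_wp1_optimal P = (\<lambda>(x1, x2).
     (x1, x2) \<in> policies P \<and>
     x1 \<in> dp_minimizers P 1 (init_level P) \<and>
     (\<forall>Q\<in>joint_ambiguity_set P. AE (d1, d2) in Q. x2 d1 \<in> dp_minimizers P 2 (x1 - d1)))"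

definition time_consistent :: "inventory \<Rightarrow> policy \<Rightarrow> bool" where
  "time_consistent P \<pi> \<longleftrightarrow> \<pi> \<in> static_optimal_policies P \<and> robust_wp1_optimal P \<pi>"

definition strongly_time_consistent :: "inventory \<Rightarrow> bool" where
  "strongly_time_consistent P \<longleftrightarrow> (\<forall>\<pi>\<in>static_optimal_policies P. time_consistent P \<pi>)"

definition example_problem :: inventory where
  "example_problem =
     \<lparr> discount = 1,
       init_level = 0,
       order_cost = (\<lambda>t. if t = 1 then 0 else 2),
       backorder_cost = (\<lambda>t. if t = 1 then 0 else 1),
       holding_cost = (\<lambda>t. if t = 1 then 0 else 1),
       demand_range = (\<lambda>t. if t = 1 then {1..3} else {0..}),
       mean = (\<lambda>t. if t = 1 then 2 else 100),
       std_dev = (\<lambda>t. if t = 1 then 1 else 5) \<rparr>"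

lemma inventory_problem_example: "inventory_problem example_problem"
  by (auto simp: inventory_problem_def example_problem_def is_interval_cc is_interval_ci)

definition example_policies :: "policy set" where
  "example_policies =
     {(x1, x2). (x1, x2) \<in> policies example_problem \<and> x1 = 102 \<and> x2 1 = 101 \<and> x2 3 = 99}"

end

theory Submission
  imports Defs
begin

text \<open>The range \<open>[1, 3]\<close> makes \<open>(d - 1) (3 - d)\<close> nonnegative, while the prescribed moments give it
  expectation 0; so the first-stage demand is uniform on \<open>{1, 3}\<close>. In the second stage ordering
  costs more than it can save, so it never pays to order. Writing \<open>c = x\<^sub>1 - 2\<close>, the static cost
  without orders is the worst-case mean of \<open>(\<bar>D - (c + 1)\<bar> + \<bar>D - (c - 1)\<bar>) / 2 \<ge> \<bar>D - c\<bar>\<close>, and the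
  two-point law on \<open>c \<plusminus> sqrt (25 + (c - 100)\<^sup>2)\<close> forces \<open>c = 100\<close>. There the integrand is
  \<open>max \<bar>D - 100\<bar> 1 \<le> (D - 100)\<^sup>2 / 10 + 5 / 2\<close>, whose mean is 5. In the DP problem the two summands
  are maximised separately, each giving \<open>sqrt (25 + 1)\<close>.\<close>

declare One_nat_def [simp del]

section \<open>Two-point laws on the real line\<close>

definition two_point :: "real \<Rightarrow> real \<Rightarrow> real \<Rightarrow> real measure" where
  "two_point p u v = distr (measure_pmf (bernoulli_pmf p)) borel (\<lambda>b. if b then u else v)"

lemma sets_two_point [simp]: "sets (two_point p u v) = sets borel"
  by (simp add: two_point_def)

lemma prob_space_two_point: "prob_space (two_point p u v)"
  unfolding two_point_def by (intro measure_pmf.prob_space_distr) auto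

lemma integrable_two_point:
  fixes f :: "real \<Rightarrow> real"
  assumes [measurable]: "f \<in> borel_measurable borel"
  shows "integrable (two_point p u v) f"
  unfolding two_point_def
  by (subst integrable_distr_eq) (auto intro!: integrable_measure_pmf_finite)

lemma integral_two_point:
  fixes f :: "real \<Rightarrow> real"
  assumes [measurable]: "f \<in> borel_measurable borel" and "0 \<le> p" "p \<le> 1"
  shows "(\<integral>d. f d \<partial>two_point p u v) = p * f u + (1 - p) * f v"
  unfolding two_point_def using assms(2,3)
  by (subst integral_distr) auto

lemma AE_two_point:
  assumes "P u" "P v" and [measurable]: "Measurable.pred borel P"
  shows "AE d in two_point p u v. P d"
  unfolding two_point_def
  by (subst AE_distr_iff) (use assms in auto)

lemma two_point_in_ambiguity_set:
  assumes "0 \<le> p" "p \<le> 1" "closed (demand_range P t)"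
    and "u \<in> demand_range P t" "v \<in> demand_range P t"
    and "p * u + (1 - p) * v = mean P t"
    and "p * u\<^sup>2 + (1 - p) * v\<^sup>2 = (mean P t)\<^sup>2 + (std_dev P t)\<^sup>2"
  shows "two_point p u v \<in> ambiguity_set P t"
proof -
  have "Measurable.pred borel (\<lambda>d. d \<in> demand_range P t)"
    using assms(3) unfolding pred_def by (simp add: borel_closed)
  then show ?thesis
    unfolding ambiguity_set_def using assms
    by (auto simp: prob_space_two_point integrable_two_point integral_two_point intro!: AE_two_point)
qed

section \<open>The first-stage ambiguity set\<close>

abbreviation M1 :: "real measure set" where "M1 \<equiv> ambiguity_set example_problem 1"
abbreviation M2 :: "real measure set" where "M2 \<equiv> ambiguity_set example_problem 2"

text \<open>A supremum over an empty family would be 0 in \<open>ennreal\<close>; a witness makes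
  the worst cases over the first stage genuine.\<close>

lemma M1_nonempty: "M1 \<noteq> {}"
proof -
  have "two_point (1/2) 1 3 \<in> M1"
    by (rule two_point_in_ambiguity_set) (auto simp: example_problem_def power2_eq_square)
  then show ?thesis by auto
qed

text \<open>Only the atoms 1 and 3 remain, and almost everywhere \<open>g\<close> agrees with a
  combination of their indicators. Arbitrary \<open>g\<close> lets this apply to \<open>V2\<close>,
  a supremum over a whole family of laws.\<close>

lemma nn_integral_M1:
  assumes "Q \<in> M1"
  shows "(\<integral>\<^sup>+ d. g d \<partial>Q) = ennreal (1/2) * g 1 + ennreal (1/2) * g 3"
    and "AE d in Q. d = 1 \<or> d = 3"
proof -
  have Q: "prob_space Q" "sets Q = sets borel" "AE d in Q. d \<in> {1..3}"
    "integrable Q (\<lambda>d. d)" "(\<integral>d. d \<partial>Q) = 2" "integrable Q (\<lambda>d. d\<^sup>2)" "(\<integral>d. d\<^sup>2 \<partial>Q) = 5"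
    using assms by (auto simp: ambiguity_set_def example_problem_def)
  interpret prob_space Q by fact
  have sp: "space Q = UNIV" using sets_eq_imp_space_eq[OF Q(2)] by simp
  have int: "integrable Q (\<lambda>d. 4 * d - d\<^sup>2 - 3)"
    using Q by auto
  have "(\<integral>d. 4 * d - d\<^sup>2 - 3 \<partial>Q) = 0"
    using Q by (simp add: prob_space)
  moreover have nonneg: "AE d in Q. 0 \<le> 4 * d - d\<^sup>2 - 3"
    using Q(3)
  proof eventually_elim
    case (elim d)
    then have "0 \<le> (d - 1) * (3 - d)" by auto
    then show ?case by (simp add: algebra_simps power2_eq_square)
  qed
  ultimately have "AE d in Q. 4 * d - d\<^sup>2 - 3 = 0"
    using integral_nonneg_eq_0_iff_AE[OF int nonneg] by simp
  then show AE: "AE d in Q. d = 1 \<or> d = 3"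
  proof eventually_elim
    case (elim d)
    then have "(d - 1) * (3 - d) = 0" by (simp add: algebra_simps power2_eq_square)
    then show ?case by auto
  qed
  note [measurable_cong] = Q(2)
  have ind [simp]: "integrable Q (indicator {a::real} :: _ \<Rightarrow> real)" for a
    using Q(2) by (auto simp: integrable_indicator_iff emeasure_eq_measure)
  have ind': "(\<integral>d. indicator {a::real} d \<partial>Q) = prob {a}" for a
    using Q(2) by (simp add: sp)
  \<comment> \<open>Total mass and mean give two linear equations for the two weights.\<close>
  have "1 = (\<integral>d. (indicator {1} d + indicator {3} d :: real) \<partial>Q)"
  proof -
    have "(\<integral>d. (1::real) \<partial>Q) = (\<integral>d. indicator {1} d + indicator {3} d \<partial>Q)"
    proof (rule integral_cong_AE)
      show "AE d in Q. (1::real) = indicator {1} d + indicator {3} d"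
        using AE by eventually_elim auto
    qed auto
    then show ?thesis using prob_space by (simp del: Bochner_Integration.integral_add)
  qed
  also have "\<dots> = prob {1} + prob {3}"
    by (subst Bochner_Integration.integral_add) (auto simp: ind')
  finally have 1: "prob {1} + prob {3} = 1" by simp
  have "2 = (\<integral>d. (indicator {1} d + 3 * indicator {3} d :: real) \<partial>Q)"
  proof -
    have "(\<integral>d. d \<partial>Q) = (\<integral>d. indicator {1} d + 3 * indicator {3} d \<partial>Q)"
    proof (rule integral_cong_AE)
      show "AE d in Q. d = indicator {1} d + 3 * indicator {3} d"
        using AE by eventually_elim auto
    qed auto
    then show ?thesis unfolding Q(5) .
  qed
  also have "\<dots> = prob {1} + 3 * prob {3}"
    by (subst Bochner_Integration.integral_add) (auto simp: ind')
  finally have 2: "prob {1} + 3 * prob {3} = 2" by simp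
  have "prob {1} = 1/2" "prob {3} = 1/2" using 1 2 by simp_all
  then have half: "emeasure Q {1} = ennreal (1/2)" "emeasure Q {3} = ennreal (1/2)"
    by (simp_all only: emeasure_eq_measure)
  have "(\<integral>\<^sup>+ d. g d \<partial>Q) = (\<integral>\<^sup>+ d. g 1 * indicator {1} d + g 3 * indicator {3} d \<partial>Q)"
  proof (rule nn_integral_cong_AE)
    show "AE d in Q. g d = g 1 * indicator {1} d + g 3 * indicator {3} d"
      using AE by eventually_elim auto
  qed
  also have "\<dots> = g 1 * emeasure Q {1} + g 3 * emeasure Q {3}"
    by (subst nn_integral_add) (auto simp: nn_integral_cmult_indicator)
  finally show "(\<integral>\<^sup>+ d. g d \<partial>Q) = ennreal (1/2) * g 1 + ennreal (1/2) * g 3"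
    by (simp add: half mult.commute)
qed

section \<open>Second-stage moments and extremal laws\<close>

lemma M2_D:
  assumes "Q \<in> M2"
  shows "prob_space Q" "sets Q = sets borel" "integrable Q (\<lambda>d. d)" "(\<integral>d. d \<partial>Q) = 100"
    "integrable Q (\<lambda>d. d\<^sup>2)" "(\<integral>d. d\<^sup>2 \<partial>Q) = 10025"
  using assms by (auto simp: ambiguity_set_def example_problem_def)

text \<open>Weak duality for the moment problem: all laws in \<open>M2\<close> give
  \<open>(d - c)^2\<close> the same mean \<open>25 + (c - 100)^2\<close>, so one quadratic majorant
  bounds every expectation at once.\<close>

lemma nn_integral_le_quadratic:
  assumes "Q \<in> M2" "\<And>d. 0 \<le> f d" "\<And>d. f d \<le> k * (d - c)\<^sup>2 + l"
    and [measurable]: "f \<in> borel_measurable borel"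
  shows "(\<integral>\<^sup>+ d. ennreal (f d) \<partial>Q) \<le> ennreal (k * (25 + (c - 100)\<^sup>2) + l)"
proof -
  note Q = M2_D[OF assms(1)]
  interpret prob_space Q by fact
  have eq: "k * (d - c)\<^sup>2 + l = k * d\<^sup>2 - (2 * k * c) * d + (k * c\<^sup>2 + l)" for d
    by (simp add: power2_eq_square algebra_simps)
  have int: "integrable Q (\<lambda>d. k * (d - c)\<^sup>2 + l)"
    unfolding eq using Q by auto
  have "(\<integral>\<^sup>+ d. ennreal (f d) \<partial>Q) \<le> (\<integral>\<^sup>+ d. ennreal (k * (d - c)\<^sup>2 + l) \<partial>Q)"
    by (intro nn_integral_mono ennreal_leI assms)
  also have "\<dots> = ennreal (\<integral>d. k * (d - c)\<^sup>2 + l \<partial>Q)"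
    using assms(2,3) by (intro nn_integral_eq_integral int) (auto intro: order_trans)
  also have "(\<integral>d. k * (d - c)\<^sup>2 + l \<partial>Q) = k * (25 + (c - 100)\<^sup>2) + l"
    unfolding eq using Q by (simp add: prob_space) (simp add: power2_eq_square algebra_simps)
  finally show ?thesis .
qed

lemma integrable_abs_diff:
  assumes "Q \<in> M2"
  shows "integrable Q (\<lambda>d. \<bar>d - y\<bar>)"
proof -
  note Q = M2_D[OF assms]
  interpret prob_space Q by fact
  show ?thesis using Q by auto
qed

lemma nn_integral_abs_diff:
  assumes "Q \<in> M2" "0 \<le> k"
  shows "(\<integral>\<^sup>+ d. ennreal (k + \<bar>d - y\<bar>) \<partial>Q) = ennreal (k + (\<integral>d. \<bar>d - y\<bar> \<partial>Q))"
proof -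
  note Q = M2_D[OF assms(1)]
  interpret prob_space Q by fact
  show ?thesis
    using assms integrable_abs_diff[OF assms(1)]
    by (subst nn_integral_eq_integral) (auto simp: prob_space)
qed

text \<open>Scarf's extremal law for the centre \<open>c\<close>, with the tangent line of its expected cost at \<open>c\<close>.\<close>

lemma extremal_law:
  assumes "95 \<le> c"
  defines "s \<equiv> sqrt (25 + (c - 100)\<^sup>2)"
  obtains Q where "Q \<in> M2" "\<And>y. s + (c - 100) / s * (y - c) \<le> (\<integral>d. \<bar>d - y\<bar> \<partial>Q)"
proof -
  have s2: "s\<^sup>2 = 25 + (c - 100)\<^sup>2" unfolding s_def by (simp add: add_nonneg_nonneg)
  have s: "0 < s" unfolding s_def by (simp add: add_pos_nonneg)
  have "\<bar>100 - c\<bar> \<le> s"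
    unfolding s_def by (rule real_le_rsqrt) (simp add: power2_commute)
  \<comment> \<open>This keeps the lower atom \<open>c - s\<close> in the demand range; after
    squaring it reads \<open>10025 \<le> 200 * c\<close>.\<close>
  moreover have "s \<le> c"
    unfolding s_def by (rule real_le_lsqrt) (use assms in \<open>auto simp: power2_eq_square algebra_simps\<close>)
  ultimately have bounds: "- s \<le> 100 - c" "100 - c \<le> s" "s \<le> c" by auto
  \<comment> \<open>The weight of the atom \<open>c + s\<close>, solved from the mean condition
    \<open>c + (2 * p - 1) * s = 100\<close>.\<close>
  define p where "p = (1 + (100 - c) / s) / 2"
  have p: "0 \<le> p" "p \<le> 1"
    using bounds s by (auto simp: p_def field_simps)
  have ps: "(2 * p - 1) * s = 100 - c" "2 * p - 1 = (100 - c) / s"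
    using s by (auto simp: p_def field_simps)
  let ?Q = "two_point p (c + s) (c - s)"
  show ?thesis
  proof
    have "p * (c + s) + (1 - p) * (c - s) = c + (2 * p - 1) * s"
      by (simp add: algebra_simps)
    then have mean: "p * (c + s) + (1 - p) * (c - s) = 100" using ps by simp
    have "p * (c + s)\<^sup>2 + (1 - p) * (c - s)\<^sup>2 = c\<^sup>2 + s\<^sup>2 + 2 * c * ((2 * p - 1) * s)"
      by (simp add: algebra_simps power2_eq_square)
    also have "\<dots> = 10025"
      unfolding ps(1) s2 by (simp add: algebra_simps power2_eq_square)
    finally show "?Q \<in> M2"
      using p mean bounds s
      by (intro two_point_in_ambiguity_set) (auto simp: example_problem_def)
    fix y
    have "s + (c - 100) / s * (y - c) = p * (c + s - y) + (1 - p) * (y - (c - s))"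
    proof -
      have "p * (c + s - y) + (1 - p) * (y - (c - s)) = s - (2 * p - 1) * (y - c)"
        by (simp add: algebra_simps)
      moreover have "(c - 100) / s = - (2 * p - 1)"
        unfolding ps(2) minus_divide_left by simp
      ultimately show ?thesis by (simp only: minus_mult_left)
    qed
    \<comment> \<open>At \<open>y = c\<close> the absolute values have exactly these signs, so the
      line touches the expected cost there; elsewhere it lies below.\<close>
    also have "\<dots> \<le> p * \<bar>c + s - y\<bar> + (1 - p) * \<bar>c - s - y\<bar>"
      using p by (intro add_mono mult_left_mono) auto
    also have "\<dots> = (\<integral>d. \<bar>d - y\<bar> \<partial>?Q)"
      using p by (simp add: integral_two_point)
    finally show "s + (c - 100) / s * (y - c) \<le> (\<integral>d. \<bar>d - y\<bar> \<partial>?Q)" .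
  qed
qed

text \<open>From 95 upwards the extremal law with centre \<open>c\<close> gives
  \<open>sqrt (25 + (c - 100)^2)\<close>; below 95 the mean alone gives
  \<open>100 - c > 5\<close>.\<close>

lemma M2_expected_deviation:
  obtains Q where "Q \<in> M2" "5 \<le> (\<integral>d. \<bar>d - c\<bar> \<partial>Q)" "c \<noteq> 100 \<Longrightarrow> 5 < (\<integral>d. \<bar>d - c\<bar> \<partial>Q)"
proof (cases "95 \<le> c")
  case True
  obtain Q where Q: "Q \<in> M2" "sqrt (25 + (c - 100)\<^sup>2) \<le> (\<integral>d. \<bar>d - c\<bar> \<partial>Q)"
  proof (rule extremal_law[OF True])
    fix Q assume "Q \<in> M2" "\<And>y. sqrt (25 + (c - 100)\<^sup>2) +
      (c - 100) / sqrt (25 + (c - 100)\<^sup>2) * (y - c) \<le> (\<integral>d. \<bar>d - y\<bar> \<partial>Q)"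
    from this(1) this(2)[of c] show thesis by (intro that[of Q]) simp_all
  qed
  have "5 \<le> sqrt (25 + (c - 100)\<^sup>2)"
    by (rule real_le_rsqrt) simp
  moreover have "5 < sqrt (25 + (c - 100)\<^sup>2)" if "c \<noteq> 100"
    by (rule real_less_rsqrt) (use that in simp)
  ultimately show ?thesis
    using Q by (intro that[of Q]) linarith+
next
  case False
  obtain Q where Q: "Q \<in> M2"
    using extremal_law[of 100] by auto
  note Q' = M2_D[OF Q]
  interpret prob_space Q by fact
  have "100 - c = (\<integral>d. d - c \<partial>Q)"
    using Q' by (simp add: prob_space)
  also have "\<dots> \<le> (\<integral>d. \<bar>d - c\<bar> \<partial>Q)"
    using Q' integrable_abs_diff[OF Q] by (intro integral_mono) auto
  finally show ?thesis
    using False Q by (intro that[of Q]) linarith+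
qed

section \<open>Reduction of the static cost to the second-stage law\<close>

lemma stage_cost_example:
  "stage_cost example_problem 1 x d = 0" "stage_cost example_problem 2 x d = \<bar>d - x\<bar>"
  by (auto simp: stage_cost_def example_problem_def)

lemma total_cost_example:
  "total_cost example_problem (x1, x2) (d1, d2) = 2 * (x2 d1 - (x1 - d1)) + \<bar>d2 - x2 d1\<bar>"
  by (simp add: total_cost_def stage_cost_example) (simp add: example_problem_def)

text \<open>\<open>a\<close> and \<open>b\<close> are the stock levels chosen after demands 1 and 3.
  Averaging over both outcomes halves the unit cost 2, so each order quantity enters with
  coefficient 1.\<close>

definition static_cost :: "real \<Rightarrow> real \<Rightarrow> real \<Rightarrow> real \<Rightarrow> real" where
  "static_cost x1 a b d = (a - (x1 - 1)) + (b - (x1 - 3)) + (\<bar>d - a\<bar> + \<bar>d - b\<bar>) / 2"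

text \<open>Off the half-line an extensional rule is the constant \<open>undefined\<close>, so
  measurability extends to the whole line, where the demand laws live.\<close>

lemma borel_measurable_policy:
  assumes "(x1, x2) \<in> policies P"
  shows "x2 \<in> borel_measurable borel"
proof -
  have "x2 \<in> borel_measurable (restrict_space borel {0..})" "x2 \<in> extensional {0..}"
    using assms by (auto simp: policies_def)
  then have "(\<lambda>d. if d \<in> {0..} then x2 d else undefined) \<in> borel_measurable borel"
    by (subst measurable_restrict_space_iff[symmetric]) auto
  also have "(\<lambda>d. if d \<in> {0..} then x2 d else undefined) = x2"
    using \<open>x2 \<in> extensional {0..}\<close> by (auto simp: extensional_def fun_eq_iff)
  finally show ?thesis .
qed

text \<open>By independence and Tonelli both first-stage outcomes end up under one integral over
  \<open>Q2\<close>. The static supremum thus acts on their average, whereas the DP takes one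
  supremum per outcome.\<close>

lemma nn_integral_total_cost:
  assumes \<pi>: "(x1, x2) \<in> policies example_problem" and Q1: "Q1 \<in> M1" and Q2: "Q2 \<in> M2"
  shows "(\<integral>\<^sup>+ \<omega>. ennreal (total_cost example_problem (x1, x2) \<omega>) \<partial>(Q1 \<Otimes>\<^sub>M Q2)) =
    (\<integral>\<^sup>+ d. ennreal (static_cost x1 (x2 1) (x2 3) d) \<partial>Q2)"
proof -
  note Q2' = M2_D[OF Q2]
  interpret Q2: prob_space Q2 by fact
  have S [measurable_cong]: "sets Q1 = sets borel" "sets Q2 = sets borel"
    using Q1 Q2 by (auto simp: ambiguity_set_def)
  have [measurable]: "x2 \<in> borel_measurable borel"
    by (rule borel_measurable_policy[OF \<pi>])
  have nn: "x1 - d \<le> x2 d" if "0 \<le> d" for d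
    using \<pi> that by (auto simp: policies_def)
  let ?f = "\<lambda>d1 d2. 2 * (x2 d1 - (x1 - d1)) + \<bar>d2 - x2 d1\<bar>"
  have "(\<integral>\<^sup>+ \<omega>. ennreal (total_cost example_problem (x1, x2) \<omega>) \<partial>(Q1 \<Otimes>\<^sub>M Q2)) =
      (\<integral>\<^sup>+ \<omega>. ennreal (?f (fst \<omega>) (snd \<omega>)) \<partial>(Q1 \<Otimes>\<^sub>M Q2))"
    by (intro nn_integral_cong) (auto simp: total_cost_example)
  also have "\<dots> = (\<integral>\<^sup>+ d1. \<integral>\<^sup>+ d2. ennreal (?f d1 d2) \<partial>Q2 \<partial>Q1)"
    by (subst Q2.nn_integral_fst[symmetric]) auto
  also have "\<dots> = ennreal (1/2) * (\<integral>\<^sup>+ d2. ennreal (?f 1 d2) \<partial>Q2) +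
      ennreal (1/2) * (\<integral>\<^sup>+ d2. ennreal (?f 3 d2) \<partial>Q2)"
    by (rule nn_integral_M1[OF Q1])
  also have "\<dots> = (\<integral>\<^sup>+ d2. ennreal (1/2) * ennreal (?f 1 d2) + ennreal (1/2) * ennreal (?f 3 d2) \<partial>Q2)"
    by (subst nn_integral_add, simp, simp, (subst nn_integral_cmult, simp)+, rule refl)
  also have "\<dots> = (\<integral>\<^sup>+ d2. ennreal (static_cost x1 (x2 1) (x2 3) d2) \<partial>Q2)"
  proof (intro nn_integral_cong)
    fix d2
    have "ennreal (1/2) * ennreal (?f 1 d2) + ennreal (1/2) * ennreal (?f 3 d2) =
        ennreal (1/2 * ?f 1 d2 + 1/2 * ?f 3 d2)"
    proof -
      have "0 \<le> 1/2 * ?f 1 d2" "0 \<le> 1/2 * ?f 3 d2"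
        using nn[of 1] nn[of 3] by auto
      then show ?thesis
        by (simp only: ennreal_mult'[symmetric] ennreal_plus)
    qed
    also have "1/2 * ?f 1 d2 + 1/2 * ?f 3 d2 = static_cost x1 (x2 1) (x2 3) d2"
      by (simp add: static_cost_def field_simps)
    finally show "ennreal (1/2) * ennreal (?f 1 d2) + ennreal (1/2) * ennreal (?f 3 d2) =
        ennreal (static_cost x1 (x2 1) (x2 3) d2)" .
  qed
  finally show ?thesis .
qed

text \<open>The integral is the same for every first-stage law, so pairing each \<open>Q2\<close>
  with one fixed \<open>Q1\<close> exhausts the supremum.\<close>

lemma worst_case_cost_example:
  assumes "(x1, x2) \<in> policies example_problem"
  shows "worst_case_cost example_problem (x1, x2) =
    (SUP Q\<in>M2. \<integral>\<^sup>+ d. ennreal (static_cost x1 (x2 1) (x2 3) d) \<partial>Q)"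
proof -
  obtain Q1 where Q1: "Q1 \<in> M1" using M1_nonempty by auto
  show ?thesis
    unfolding worst_case_cost_def joint_ambiguity_set_def
  proof (intro antisym SUP_least)
    fix Q assume "Q \<in> {Q1 \<Otimes>\<^sub>M Q2 |Q1 Q2. Q1 \<in> M1 \<and> Q2 \<in> M2}"
    then obtain Q1 Q2 where Q: "Q = Q1 \<Otimes>\<^sub>M Q2" "Q1 \<in> M1" "Q2 \<in> M2" by auto
    then show "(\<integral>\<^sup>+ \<omega>. ennreal (total_cost example_problem (x1, x2) \<omega>) \<partial>Q) \<le>
        (SUP Q\<in>M2. \<integral>\<^sup>+ d. ennreal (static_cost x1 (x2 1) (x2 3) d) \<partial>Q)"
      unfolding Q(1) nn_integral_total_cost[OF assms Q(2,3)] by (intro SUP_upper)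
  next
    fix Q2 assume Q2: "Q2 \<in> M2"
    show "(\<integral>\<^sup>+ d. ennreal (static_cost x1 (x2 1) (x2 3) d) \<partial>Q2) \<le>
        (SUP Q\<in>{Q1 \<Otimes>\<^sub>M Q2 |Q1 Q2. Q1 \<in> M1 \<and> Q2 \<in> M2}.
          \<integral>\<^sup>+ \<omega>. ennreal (total_cost example_problem (x1, x2) \<omega>) \<partial>Q)"
      unfolding nn_integral_total_cost[OF assms Q1 Q2, symmetric]
      by (intro SUP_upper) (use Q1 Q2 in blast)
  qed
qed

section \<open>Optimal static policies\<close>

lemma worst_case_cost_ge:
  assumes \<pi>: "(x1, x2) \<in> policies example_problem"
  shows "5 \<le> worst_case_cost example_problem (x1, x2)"
    and "worst_case_cost example_problem (x1, x2) = 5 \<Longrightarrow> (x1, x2) \<in> example_policies"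
proof -
  \<comment> \<open>Half the sum of the two order quantities, so ordering costs \<open>2 * k\<close>
    in the mean.\<close>
  define k where "k = (x2 1 - (x1 - 1) + (x2 3 - (x1 - 3))) / 2"
  have nn: "x1 - 1 \<le> x2 1" "x1 - 3 \<le> x2 3"
    using \<pi> by (auto simp: policies_def)
  then have k: "0 \<le> k" by (simp add: k_def)
  obtain Q where Q: "Q \<in> M2" "5 \<le> (\<integral>d. \<bar>d - (x1 - 2)\<bar> \<partial>Q)"
    "x1 - 2 \<noteq> 100 \<Longrightarrow> 5 < (\<integral>d. \<bar>d - (x1 - 2)\<bar> \<partial>Q)"
    using M2_expected_deviation[of "x1 - 2"] by blast
  let ?E = "\<integral>d. \<bar>d - (x1 - 2)\<bar> \<partial>Q"
  \<comment> \<open>The midpoint of \<open>x2 1\<close> and \<open>x2 3\<close> is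
    \<open>x1 - 2 + k\<close>. Moving the centre back to \<open>x1 - 2\<close> loses at most
    \<open>k\<close> of the ordering cost \<open>2 * k\<close>, which leaves a surplus of
    \<open>k\<close>.\<close>
  have "k + \<bar>d - (x1 - 2)\<bar> \<le> static_cost x1 (x2 1) (x2 3) d" for d
  proof -
    have "\<bar>d - (x1 - 2)\<bar> \<le> k + (\<bar>d - x2 1\<bar> + \<bar>d - x2 3\<bar>) / 2"
      using k unfolding k_def by (intro abs_leI) argo+
    then show ?thesis unfolding k_def static_cost_def by argo
  qed
  then have "(\<integral>\<^sup>+ d. ennreal (k + \<bar>d - (x1 - 2)\<bar>) \<partial>Q) \<le>
      (\<integral>\<^sup>+ d. ennreal (static_cost x1 (x2 1) (x2 3) d) \<partial>Q)"
    by (intro nn_integral_mono ennreal_leI)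
  also have "\<dots> \<le> worst_case_cost example_problem (x1, x2)"
    unfolding worst_case_cost_example[OF \<pi>] by (intro SUP_upper Q)
  finally have *: "ennreal (k + ?E) \<le> worst_case_cost example_problem (x1, x2)"
    by (simp only: nn_integral_abs_diff[OF Q(1) k])
  have "ennreal 5 \<le> ennreal (k + ?E)"
    using k Q(2) by (intro ennreal_leI) simp
  with * have "ennreal 5 \<le> worst_case_cost example_problem (x1, x2)" by (rule order_trans[rotated])
  then show "5 \<le> worst_case_cost example_problem (x1, x2)" by simp
  assume "worst_case_cost example_problem (x1, x2) = 5"
  with * have "ennreal (k + ?E) \<le> ennreal 5" by simp
  then have "k + ?E \<le> 5" by (subst (asm) ennreal_le_iff) auto
  \<comment> \<open>A value of 5 leaves no room for the surplus \<open>k\<close>, nor for the strict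
    excess that any centre other than 100 produces.\<close>
  then have "k = 0" "x1 = 102" using k Q(2,3) by linarith+
  then have "x2 1 = 101" "x2 3 = 99" using nn by (auto simp: k_def)
  with \<open>x1 = 102\<close> \<pi> show "(x1, x2) \<in> example_policies"
    by (simp add: example_policies_def)
qed

lemma worst_case_cost_example_policies:
  assumes "\<pi> \<in> example_policies"
  shows "worst_case_cost example_problem \<pi> = 5"
proof -
  obtain x2 where \<pi>: "\<pi> = (102, x2)" "(102, x2) \<in> policies example_problem" "x2 1 = 101" "x2 3 = 99"
    using assms by (auto simp: example_policies_def)
  have "(SUP Q\<in>M2. \<integral>\<^sup>+ d. ennreal (static_cost 102 101 99 d) \<partial>Q) \<le> 5"
  proof (intro SUP_least)
    fix Q assume Q: "Q \<in> M2"
    \<comment> \<open>The parabola touches \<open>|d - 100|\<close> at 95 and 105, the atoms of the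
      extremal law with centre 100; its minimum 5/2 clears the plateau of height 1.\<close>
    have "static_cost 102 101 99 d \<le> 1 / 10 * (d - 100)\<^sup>2 + 5 / 2" for d
    proof -
      have "static_cost 102 101 99 d = max \<bar>d - 100\<bar> 1" unfolding static_cost_def by argo
      moreover have "0 \<le> (\<bar>d - 100\<bar> - 5)\<^sup>2" by simp
      then have "10 * \<bar>d - 100\<bar> \<le> (d - 100)\<^sup>2 + 25"
        by (simp only: power2_diff power2_abs) simp
      moreover have "0 \<le> (d - 100)\<^sup>2" by simp
      ultimately show ?thesis by argo
    qed
    then have "(\<integral>\<^sup>+ d. ennreal (static_cost 102 101 99 d) \<partial>Q) \<le>
        ennreal (1 / 10 * (25 + (100 - 100)\<^sup>2) + 5 / 2)"
      by (intro nn_integral_le_quadratic Q) (auto simp: static_cost_def)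
    then show "(\<integral>\<^sup>+ d. ennreal (static_cost 102 101 99 d) \<partial>Q) \<le> 5" by simp
  qed
  then have "worst_case_cost example_problem (102, x2) \<le> 5"
    by (simp add: worst_case_cost_example[OF \<pi>(2)] \<pi>(3,4))
  then show ?thesis
    unfolding \<pi>(1) by (intro antisym worst_case_cost_ge(1) \<pi>(2))
qed

text \<open>The policy that starts at 102 and never orders again shows that the value 5 is
  attained.\<close>

lemma example_policies_nonempty: "example_policies \<noteq> {}"
proof -
  have "(\<lambda>d::real. if d \<in> {0..} then 102 - d else undefined) \<in> borel_measurable borel"
    by measurable
  then have "restrict (\<lambda>d::real. 102 - d) {0..} \<in> borel_measurable (restrict_space borel {0..})"
    unfolding restrict_def by (rule measurable_restrict_space1)
  then have "(102, restrict (\<lambda>d. 102 - d) {0..}) \<in> example_policies"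
    by (auto simp: example_policies_def policies_def example_problem_def)
  then show ?thesis by auto
qed

lemma example_policies_subset: "example_policies \<subseteq> policies example_problem"
  by (auto simp: example_policies_def)

lemma static_value_example: "static_value example_problem = 5"
  unfolding static_value_def
proof (intro antisym INF_greatest)
  obtain \<pi> where \<pi>: "\<pi> \<in> example_policies" using example_policies_nonempty by auto
  then show "(INF \<pi>\<in>policies example_problem. worst_case_cost example_problem \<pi>) \<le> 5"
    using worst_case_cost_example_policies[OF \<pi>] example_policies_subset
    by (intro INF_lower2[of \<pi>]) auto
  show "5 \<le> worst_case_cost example_problem \<pi>" if "\<pi> \<in> policies example_problem" for \<pi>
    using worst_case_cost_ge(1) that by (cases \<pi>) auto
qed

lemma static_optimal_policies_example:
  "static_optimal_policies example_problem = example_policies"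
  unfolding static_optimal_policies_def static_value_example
  using worst_case_cost_example_policies example_policies_subset worst_case_cost_ge(2) by auto

section \<open>Value functions of the dynamic program\<close>

definition V2 :: "real \<Rightarrow> ennreal" where
  "V2 y = (SUP Q\<in>M2. \<integral>\<^sup>+ d. ennreal \<bar>d - y\<bar> \<partial>Q)"

lemma dp_objective_2:
  "dp_objective example_problem 2 (dp_value_function example_problem (Suc 2)) y x =
    ennreal (2 * (x - y)) + V2 x"
proof -
  have "dp_value_function example_problem (Suc 2) = (\<lambda>_. 0)"
    by (subst dp_value_function.simps) simp
  moreover have "order_cost example_problem 2 = 2"
    by (simp add: example_problem_def)
  ultimately show ?thesis
    by (simp only: dp_objective_def stage_cost_example V2_def) simp
qed

text \<open>Raising the stock from \<open>y\<close> to \<open>x\<close> lowers the deviation by at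
  most \<open>x - y\<close> but costs twice that. Hence not ordering is optimal and
  \<open>V2\<close> is the second-stage value function.\<close>

lemma V2_le:
  assumes "y \<le> x"
  shows "V2 y \<le> ennreal (2 * (x - y)) + V2 x"
  unfolding V2_def[of y]
proof (intro SUP_least)
  fix Q assume Q: "Q \<in> M2"
  note Q' = M2_D[OF Q]
  interpret prob_space Q by fact
  note [measurable_cong] = Q'(2)
  have "(\<integral>\<^sup>+ d. ennreal \<bar>d - y\<bar> \<partial>Q) \<le> (\<integral>\<^sup>+ d. ennreal (2 * (x - y)) + ennreal \<bar>d - x\<bar> \<partial>Q)"
    using assms
    by (intro nn_integral_mono) (auto simp flip: ennreal_plus intro!: ennreal_leI)
  also have "\<dots> = ennreal (2 * (x - y)) + (\<integral>\<^sup>+ d. ennreal \<bar>d - x\<bar> \<partial>Q)"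
    by (subst nn_integral_add) (auto simp: emeasure_space_1)
  also have "\<dots> \<le> ennreal (2 * (x - y)) + V2 x"
    unfolding V2_def by (intro add_left_mono SUP_upper Q)
  finally show "(\<integral>\<^sup>+ d. ennreal \<bar>d - y\<bar> \<partial>Q) \<le> ennreal (2 * (x - y)) + V2 x" .
qed

lemma dp_value_function_2: "dp_value_function example_problem 2 = V2"
proof
  fix y
  have "dp_value_function example_problem 2 y = (INF x\<in>{y..}. ennreal (2 * (x - y)) + V2 x)"
    by (subst dp_value_function.simps) (simp add: dp_objective_2 del: Suc_numeral)
  also have "\<dots> = V2 y"
    by (intro antisym INF_greatest INF_lower2[of y] V2_le) auto
  finally show "dp_value_function example_problem 2 y = V2 y" .
qed

lemma dp_minimizers_2: "y \<in> dp_minimizers example_problem 2 y"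
  unfolding dp_minimizers_def dp_objective_2 by (simp add: dp_value_function_2)

text \<open>With the centre \<open>c\<close> fixed, the bound holds for every \<open>y\<close>,
  including levels below 95 at which \<open>extremal_law\<close> cannot be centred.\<close>

lemma V2_tangent:
  assumes "95 \<le> c"
  shows "ennreal (sqrt (25 + (c - 100)\<^sup>2) + (c - 100) / sqrt (25 + (c - 100)\<^sup>2) * (y - c)) \<le> V2 y"
proof -
  obtain Q where Q: "Q \<in> M2"
    "sqrt (25 + (c - 100)\<^sup>2) + (c - 100) / sqrt (25 + (c - 100)\<^sup>2) * (y - c) \<le> (\<integral>d. \<bar>d - y\<bar> \<partial>Q)"
    using extremal_law[OF assms] by metis
  then have "ennreal (sqrt (25 + (c - 100)\<^sup>2) + (c - 100) / sqrt (25 + (c - 100)\<^sup>2) * (y - c)) \<le>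
      (\<integral>\<^sup>+ d. ennreal \<bar>d - y\<bar> \<partial>Q)"
    using nn_integral_abs_diff[OF Q(1), of 0 y] by (simp add: ennreal_leI)
  also have "\<dots> \<le> V2 y" unfolding V2_def by (intro SUP_upper Q)
  finally show ?thesis .
qed

text \<open>Cauchy-Schwarz in parabola form: \<open>s\<close> is the root mean square of
  \<open>d - y\<close>, and the parabola touching \<open>|d - y|\<close> at distance
  \<open>s\<close> from \<open>y\<close> has mean exactly \<open>s\<close>.\<close>

lemma V2_upper: "V2 y \<le> ennreal (sqrt (25 + (y - 100)\<^sup>2))"
  unfolding V2_def
proof (intro SUP_least)
  fix Q assume Q: "Q \<in> M2"
  define s where "s = sqrt (25 + (y - 100)\<^sup>2)"
  have s: "0 < s" "s * s = 25 + (y - 100)\<^sup>2"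
    unfolding s_def by (auto simp: add_pos_nonneg)
  have bound: "\<bar>d - y\<bar> \<le> 1 / (2 * s) * (d - y)\<^sup>2 + s / 2" for d
  proof -
    have "0 \<le> (\<bar>d - y\<bar> - s)\<^sup>2" by simp
    then have "2 * s * \<bar>d - y\<bar> \<le> (d - y)\<^sup>2 + s * s"
      by (simp only: power2_diff[of _ s] power2_abs) (simp add: power2_eq_square mult.commute mult.left_commute)
    then show ?thesis using s(1) by (simp add: field_simps)
  qed
  have "(\<integral>\<^sup>+ d. ennreal \<bar>d - y\<bar> \<partial>Q) \<le> ennreal (1 / (2 * s) * (25 + (y - 100)\<^sup>2) + s / 2)"
    by (intro nn_integral_le_quadratic Q bound) auto
  also have "1 / (2 * s) * (25 + (y - 100)\<^sup>2) + s / 2 = s"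
    using s(1) unfolding s(2)[symmetric] by (simp add: field_simps)
  finally show "(\<integral>\<^sup>+ d. ennreal \<bar>d - y\<bar> \<partial>Q) \<le> ennreal (sqrt (25 + (y - 100)\<^sup>2))"
    by (simp add: s_def)
qed

text \<open>Stage 1 has no costs of its own and all laws in \<open>M1\<close> integrate alike, so
  its supremum is trivial; the worst cases sit inside \<open>V2\<close>, one for each
  demand.\<close>

lemma dp_objective_1:
  "dp_objective example_problem 1 (dp_value_function example_problem (Suc 1)) y x =
    ennreal (1/2) * V2 (x - 1) + ennreal (1/2) * V2 (x - 3)"
proof -
  have "dp_objective example_problem 1 (dp_value_function example_problem (Suc 1)) y x =
      (SUP Q\<in>M1. \<integral>\<^sup>+ d. V2 (x - d) \<partial>Q)"
    using dp_value_function_2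
    by (simp add: dp_objective_def stage_cost_example numeral_2_eq_2 del: One_nat_def)
       (simp add: example_problem_def)
  also have "\<dots> = (SUP Q\<in>M1. ennreal (1/2) * V2 (x - 1) + ennreal (1/2) * V2 (x - 3))"
    by (intro SUP_cong refl) (simp only: nn_integral_M1(1))
  also have "\<dots> = ennreal (1/2) * V2 (x - 1) + ennreal (1/2) * V2 (x - 3)"
    using M1_nonempty by simp
  finally show ?thesis .
qed

text \<open>The tangents at \<open>101\<close> and \<open>99\<close> have opposite slopes, so they cancel in the sum.\<close>

lemma dp_objective_1_ge:
  "ennreal (sqrt 26) \<le> ennreal (1/2) * V2 (x - 1) + ennreal (1/2) * V2 (x - 3)"
proof -
  let ?a = "sqrt 26 + (x - 102) / sqrt 26" and ?b = "sqrt 26 - (x - 102) / sqrt 26"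
  have a: "ennreal ?a \<le> V2 (x - 1)" using V2_tangent[of 101 "x - 1"] by simp
  have b: "ennreal ?b \<le> V2 (x - 3)" using V2_tangent[of 99 "x - 3"] by (simp add: diff_divide_distrib algebra_simps)
  have "sqrt 26 = 1/2 * ?a + 1/2 * ?b" by argo
  \<comment> \<open>Far from \<open>x = 102\<close> one tangent value is negative and
    \<open>ennreal\<close> sends it to 0; passing to positive parts only raises the average.\<close>
  also have "\<dots> \<le> 1/2 * max 0 ?a + 1/2 * max 0 ?b" by (intro add_mono mult_left_mono) auto
  finally have "ennreal (sqrt 26) \<le> ennreal (1/2 * max 0 ?a + 1/2 * max 0 ?b)"
    by (rule ennreal_leI)
  also have "\<dots> = ennreal (1/2) * ennreal ?a + ennreal (1/2) * ennreal ?b"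
  proof -
    have "ennreal (max 0 r) = ennreal r" for r
      by (auto simp: max_def ennreal_neg)
    then show ?thesis
      by (subst ennreal_plus) (simp_all add: ennreal_mult' del: times_divide_eq_left)
  qed
  also have "\<dots> \<le> ennreal (1/2) * V2 (x - 1) + ennreal (1/2) * V2 (x - 3)"
    by (intro add_mono mult_left_mono a b) auto
  finally show ?thesis .
qed

text \<open>The levels 101 and 99 both lie at distance 1 from the mean 100, so
  \<open>V2_upper\<close> gives \<open>sqrt (25 + 1)\<close> for each.\<close>

lemma dp_objective_1_optimum:
  "ennreal (1/2) * V2 (102 - 1) + ennreal (1/2) * V2 (102 - 3) = ennreal (sqrt 26)"
proof (rule antisym[OF _ dp_objective_1_ge])
  have "V2 (102 - 1) \<le> ennreal (sqrt 26)" "V2 (102 - 3) \<le> ennreal (sqrt 26)"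
    using V2_upper[of 101] V2_upper[of 99] by simp_all
  then have "ennreal (1/2) * V2 (102 - 1) + ennreal (1/2) * V2 (102 - 3) \<le>
      ennreal (1/2) * ennreal (sqrt 26) + ennreal (1/2) * ennreal (sqrt 26)"
    by (intro add_mono mult_left_mono) auto
  also have "\<dots> = ennreal (sqrt 26)"
    by (subst (1 2) ennreal_mult'[symmetric]) (simp_all flip: ennreal_plus)
  finally show "ennreal (1/2) * V2 (102 - 1) + ennreal (1/2) * V2 (102 - 3) \<le> ennreal (sqrt 26)" .
qed

lemma dp_value_function_1: "dp_value_function example_problem 1 0 = ennreal (sqrt 26)"
proof -
  have "dp_value_function example_problem 1 0 =
      (INF x\<in>{0..}. ennreal (1/2) * V2 (x - 1) + ennreal (1/2) * V2 (x - 3))"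
    by (subst dp_value_function.simps) (simp add: dp_objective_1 del: Suc_numeral Suc_1)
  also have "\<dots> = ennreal (sqrt 26)"
    by (intro antisym INF_greatest dp_objective_1_ge INF_lower2[of 102])
       (simp_all only: dp_objective_1_optimum order_refl, simp)
  finally show ?thesis .
qed

section \<open>Time consistency\<close>

lemma robust_wp1_optimal_example:
  assumes "\<pi> \<in> example_policies"
  shows "robust_wp1_optimal example_problem \<pi>"
proof -
  obtain x2 where \<pi>: "\<pi> = (102, x2)" "(102, x2) \<in> policies example_problem" "x2 1 = 101" "x2 3 = 99"
    using assms by (auto simp: example_policies_def)
  have "init_level example_problem = 0" by (simp add: example_problem_def)
  then have 1: "102 \<in> dp_minimizers example_problem 1 (init_level example_problem)"
    unfolding dp_minimizers_def dp_objective_1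
    using dp_value_function_1 dp_objective_1_optimum by simp
  \<comment> \<open>Only demands 1 and 3 carry mass, and there \<open>x2\<close> orders nothing;
    elsewhere it may order.\<close>
  have 2: "x2 d \<in> dp_minimizers example_problem 2 (102 - d)" if "d = 1 \<or> d = 3" for d
    using that \<pi>(3,4) dp_minimizers_2[of 101] dp_minimizers_2[of 99] by auto
  have "AE (d1, d2) in Q. x2 d1 \<in> dp_minimizers example_problem 2 (102 - d1)"
    if "Q \<in> joint_ambiguity_set example_problem" for Q
  proof -
    obtain Q1 Q2 where Q: "Q = Q1 \<Otimes>\<^sub>M Q2" "Q1 \<in> M1" "Q2 \<in> M2"
      using \<open>Q \<in> joint_ambiguity_set example_problem\<close> unfolding joint_ambiguity_set_def by blast
    interpret Q1: prob_space Q1 using Q(2) by (simp add: ambiguity_set_def)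
    interpret Q2: prob_space Q2 using Q(3) by (simp add: ambiguity_set_def)
    interpret pair_sigma_finite Q1 Q2 ..
    have [measurable_cong]: "sets Q1 = sets borel" "sets Q2 = sets borel"
      using Q(2,3) by (auto simp: ambiguity_set_def)
    have "AE \<omega> in Q1 \<Otimes>\<^sub>M Q2. fst \<omega> = 1 \<or> fst \<omega> = 3"
      using nn_integral_M1(2)[OF Q(2)] by (intro AE_pair_measure) auto
    then show ?thesis
      unfolding Q(1) by eventually_elim (auto intro: 2)
  qed
  with \<pi>(1,2) 1 show ?thesis by (simp add: robust_wp1_optimal_def)
qed

theorem theorem7:
  shows "static_optimal_policies example_problem = example_policies \<and>
         strongly_time_consistent example_problem \<and>
         static_value example_problem = 5 \<and>
         dp_optimal_value example_problem = ennreal (sqrt 26) \<and>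
         sqrt 26 > (5 :: real)"
proof (intro conjI)
  show "strongly_time_consistent example_problem"
    by (simp add: strongly_time_consistent_def time_consistent_def
        static_optimal_policies_example robust_wp1_optimal_example)
  show "dp_optimal_value example_problem = ennreal (sqrt 26)"
    using dp_value_function_1 by (simp add: dp_optimal_value_def example_problem_def)
  show "sqrt 26 > (5 :: real)"
    by (rule real_less_rsqrt) simp
qed (fact static_optimal_policies_example static_value_example)+

end
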